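(* Let $G$ and $G'$ be marked groups with subgroup trees $T_G$ and $T_{G'}$. If $G\cong G'$ as groups, then $\rho(T_G)=\rho(T_{G'})$.
   Context: Let $\mathbb{F}_\omega$ be the free group on countably many letters, with a fixed enumeration $(\gamma_i)_{i\in\mathbb{N}}$ of its elements. A marked group is $G=\mathbb{F}_\omega/N$ with $N\trianglelefteq\mathbb{F}_\omega$; it carries the enumeration $g_i:=\gamma_iN$, $i\in\mathbb{N}$ (repetitions allowed). For $s=(s_0,\dots,s_n)\in\mathbb{N}^{<\mathbb{N}}$ write $\{g_s\}=\{g_{s_0},\dots,g_{s_n}\}$, with $\{g_\emptyset\}=\emptyset$. The subgroup tree $T_G\subseteq\mathbb{N}^{<\mathbb{N}}$ is defined recursively, writing $(s,i)$ for the sequence $s$ extended by the term $i$: $\emptyset\in T_G$; and if $s\in T_G$ and $i\in\mathbb{N}$, then $(s,i)\in T_G$ if and only if $\langle\{g_s\}\cup\{g_i\}\rangle\ne\langle\{g_s\}\rangle$ (where $\langle\emptyset\rangle=\{e\}$). A tree is a set $T\subseteq\mathbb{N}^{<\mathbb{N}}$ closed under initial segments; it is well-founded if there is no $x\in\mathbb{N}^{\mathbb{N}}$ all of whose finite initial segments lie in $T$. For a nonempty well-founded tree $T$, define $\rho_T(t)=\sup\{\rho_T(s)+1\mid s\in T,\ t\subsetneq s\}$ (so $\rho_T(t)=0$ if $t$ has no proper extension in $T$) and $\rho(T)=\rho_T(\emptyset)+1$; put $\rho(\emptyset)=0$, and $\rho(T)=\omega_1$ if $T$ is not well-founded. *)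

theory Defs
  imports "HOL-Algebra.Generated_Groups" "HOL-Library.Sublist" "HOL-Library.Countable_Set"
begin

text \<open>A letter \<open>(k, True)\<close> stands for the generator \<open>x\<^sub>k\<close> and \<open>(k, False)\<close> for its inverse;
  group elements are reduced words.\<close>

type_synonym letter = "nat \<times> bool"

definition inv_letter :: "letter \<Rightarrow> letter" where
  "inv_letter x = (fst x, \<not> snd x)"

fun reduced :: "letter list \<Rightarrow> bool" where
  "reduced [] \<longleftrightarrow> True"
| "reduced [x] \<longleftrightarrow> True"
| "reduced (x # y # w) \<longleftrightarrow> y \<noteq> inv_letter x \<and> reduced (y # w)"

fun cancel_cons :: "letter \<Rightarrow> letter list \<Rightarrow> letter list" where
  "cancel_cons x [] = [x]"
| "cancel_cons x (y # w) = (if y = inv_letter x then w else x # y # w)"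

definition free_group :: "letter list monoid" where
  "free_group = \<lparr>carrier = {w. reduced w}, mult = (\<lambda>u v. foldr cancel_cons u v), one = []\<rparr>"

lemma inv_letter_invol [simp]: "inv_letter (inv_letter x) = x"
  by (simp add: inv_letter_def)

lemma inv_letter_neq [simp]: "inv_letter x \<noteq> x"
  by (simp add: inv_letter_def prod_eq_iff)

lemma reduced_tl: "reduced (x # w) \<Longrightarrow> reduced w"
  by (cases w) auto

lemma reduced_cancel_cons: "reduced w \<Longrightarrow> reduced (cancel_cons x w)"
  by (cases w) (auto dest: reduced_tl)

lemma reduced_foldr: "reduced v \<Longrightarrow> reduced (foldr cancel_cons u v)"
  by (induction u) (auto intro: reduced_cancel_cons)

lemma cancel_cons_inverse:
  assumes "reduced w"
  shows "cancel_cons x (cancel_cons (inv_letter x) w) = w"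
proof (cases w)
  case (Cons y w')
  then show ?thesis using assms by (cases w') auto
qed auto

lemma cancel_cons_inverse':
  assumes "reduced w"
  shows "cancel_cons (inv_letter x) (cancel_cons x w) = w"
  using cancel_cons_inverse[OF assms, of "inv_letter x"] by simp

lemma foldr_cancel_cons:
  assumes "reduced w"
  shows "foldr cancel_cons (cancel_cons x v) w = cancel_cons x (foldr cancel_cons v w)"
proof (cases v)
  case (Cons y v')
  then show ?thesis
    using cancel_cons_inverse[OF reduced_foldr[OF assms], of x v'] by auto
qed auto

lemma foldr_cancel_assoc:
  assumes "reduced w"
  shows "foldr cancel_cons (foldr cancel_cons u v) w = foldr cancel_cons u (foldr cancel_cons v w)"
  by (induction u) (simp_all add: foldr_cancel_cons assms)

lemma foldr_cancel_Nil: "reduced w \<Longrightarrow> foldr cancel_cons w [] = w"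
proof (induction w)
  case (Cons x w)
  then show ?case by (cases w) auto
qed auto

lemma foldr_cancel_inverse:
  "reduced v \<Longrightarrow> foldr cancel_cons (rev (map inv_letter w)) (foldr cancel_cons w v) = v"
  by (induction w arbitrary: v) (auto simp: cancel_cons_inverse' reduced_foldr)

lemma group_free_group: "group free_group"
proof (rule groupI)
  fix w assume w: "w \<in> carrier free_group"
  define u where "u = foldr cancel_cons (rev (map inv_letter w)) []"
  have "foldr cancel_cons u w = foldr cancel_cons (rev (map inv_letter w)) (foldr cancel_cons w [])"
    using w by (simp add: u_def foldr_cancel_assoc free_group_def foldr_cancel_Nil)
  also have "\<dots> = []"
    by (rule foldr_cancel_inverse) simp
  finally show "\<exists>y\<in>carrier free_group. y \<otimes>\<^bsub>free_group\<^esub> w = \<one>\<^bsub>free_group\<^esub>"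
    by (intro bexI[of _ u]) (auto simp: free_group_def u_def reduced_foldr)
qed (auto simp: free_group_def reduced_foldr foldr_cancel_assoc)

definition marked_group :: "letter list set \<Rightarrow> letter list set monoid" where
  "marked_group N = free_group Mod N"

text \<open>The library's quotient has right cosets as elements; for normal \<open>N\<close> the left cosets below
  are the same sets.\<close>

definition marking :: "(nat \<Rightarrow> letter list) \<Rightarrow> letter list set \<Rightarrow> nat \<Rightarrow> letter list set" where
  "marking \<gamma> N i = \<gamma> i <#\<^bsub>free_group\<^esub> N"

inductive_set gen_tree :: "('a, 'b) monoid_scheme \<Rightarrow> (nat \<Rightarrow> 'a) \<Rightarrow> nat list set"
  for G :: "('a, 'b) monoid_scheme" and g :: "nat \<Rightarrow> 'a" where
  Nil: "[] \<in> gen_tree G g"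
| snoc: "s \<in> gen_tree G g \<Longrightarrow> generate G (g ` set s \<union> {g i}) \<noteq> generate G (g ` set s)
    \<Longrightarrow> s @ [i] \<in> gen_tree G g"

lemma gen_tree_snoc_iff:
  "s @ [i] \<in> gen_tree G g \<longleftrightarrow>
     s \<in> gen_tree G g \<and> generate G (g ` set s \<union> {g i}) \<noteq> generate G (g ` set s)"
  by (auto elim: gen_tree.cases intro: gen_tree.snoc)

definition subgroup_tree :: "(nat \<Rightarrow> letter list) \<Rightarrow> letter list set \<Rightarrow> nat list set" where
  "subgroup_tree \<gamma> N = gen_tree (marked_group N) (marking \<gamma> N)"

text \<open>HOL has no type of all ordinals.  The initial well-order of cardinality \<open>\<aleph>\<^sub>2\<close> represents every
  ordinal below \<open>\<omega>\<^sub>2\<close>; it contains \<open>\<omega>\<^sub>1\<close>, has no largest element, and its countable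
  subsets are bounded, so successors and countable suprema are the usual ones.\<close>

abbreviation aleph2 :: "nat set set rel" where
  "aleph2 \<equiv> cardSuc (cardSuc natLeq)"

lemma Card_order_aleph1: "Card_order (cardSuc natLeq)"
  by (simp add: cardSuc_Card_order natLeq_Card_order)

lemma Card_order_aleph2: "Card_order aleph2"
  by (simp add: cardSuc_Card_order Card_order_aleph1)

lemma Well_order_aleph2: "Well_order aleph2"
  using Card_order_aleph2 card_order_on_well_order_on by blast

lemma infinite_aleph2: "infinite (Field aleph2)"
  by (metis cardSuc_finite Card_order_aleph1 natLeq_Card_order Field_natLeq infinite_UNIV_nat)

typedef ordinal = "Field aleph2"
proof -
  have "Field aleph2 \<noteq> {}" using infinite_aleph2 by force
  then show ?thesis by blast
qed

instantiation ordinal :: wellorder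
begin

definition less_eq_ordinal :: "ordinal \<Rightarrow> ordinal \<Rightarrow> bool" where
  "a \<le> b \<longleftrightarrow> (Rep_ordinal a, Rep_ordinal b) \<in> aleph2"

definition less_ordinal :: "ordinal \<Rightarrow> ordinal \<Rightarrow> bool" where
  "(a :: ordinal) < b \<longleftrightarrow> a \<le> b \<and> a \<noteq> b"

instance
proof -
  note wo = Well_order_aleph2[unfolded well_order_on_def linear_order_on_def
      partial_order_on_def preorder_on_def]
  have "refl_on (Field aleph2) aleph2" and "trans aleph2" and "antisym aleph2"
    and "total_on (Field aleph2) aleph2" and wf: "wf (aleph2 - Id)"
    using wo by auto
  then have refl: "a \<le> a" and tr: "a \<le> b \<Longrightarrow> b \<le> c \<Longrightarrow> a \<le> c"
    and anti: "a \<le> b \<Longrightarrow> b \<le> a \<Longrightarrow> a = b" and tot: "a \<le> b \<or> b \<le> a" for a b c :: ordinal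
    unfolding less_eq_ordinal_def
    using Rep_ordinal[of a] Rep_ordinal[of b] Rep_ordinal_inject[of a b]
    unfolding total_on_def by (metis refl_onD transD antisymD)+
  have ind: "P a" if step: "\<And>x. (\<And>y. y < x \<Longrightarrow> P y) \<Longrightarrow> P x" for P and a :: ordinal
  proof -
    have "wf {(x::ordinal, y). x < y}"
      by (rule wf_subset[OF wf_inv_image[OF wf, of Rep_ordinal]])
         (auto simp: inv_image_def less_ordinal_def less_eq_ordinal_def Rep_ordinal_inject)
    then show ?thesis
      by (induction a rule: wf_induct_rule) (auto intro: step)
  qed
  show "OFCLASS(ordinal, wellorder_class)"
    by standard (use refl tr anti tot in \<open>auto simp: less_ordinal_def intro: ind\<close>)
qed

end

lemma countable_bdd_above_ordinal:
  includes cardinal_syntax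
  fixes X :: "ordinal set"
  assumes "countable X"
  shows "bdd_above X"
proof (rule ccontr)
  assume unbdd: "\<not> bdd_above X"
  let ?K = "Rep_ordinal ` X"
  have "cofinal ?K aleph2"
    unfolding cofinal_def
  proof
    fix a assume "a \<in> Field aleph2"
    then obtain x where x: "a = Rep_ordinal x"
      by (metis Abs_ordinal_inverse)
    obtain y where "y \<in> X" "\<not> y \<le> x"
      using unbdd by (auto simp: bdd_above_def)
    then show "\<exists>b\<in>?K. a \<noteq> b \<and> (a, b) \<in> aleph2"
      using x by (intro bexI[of _ "Rep_ordinal y"])
        (use less_eq_ordinal_def linorder_le_cases[of x y] in auto)
  qed
  moreover have "?K \<subseteq> Field aleph2"
    using Rep_ordinal by auto
  moreover have "Cinfinite (cardSuc natLeq)"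
    using Cinfinite_cardSuc natLeq_Cinfinite by blast
  ultimately have iso: "|?K| =o aleph2"
    using regularCard_cardSuc unfolding regularCard_def by blast
  have "countable ?K" using assms by simp
  then have "|?K| \<le>o natLeq"
    by (meson card_of_nat countable_def card_of_ordLeq ordLeq_ordIso_trans subset_UNIV)
  moreover have "natLeq <o aleph2"
    using cardSuc_greater[OF natLeq_Card_order] cardSuc_greater[OF Card_order_aleph1]
      ordLess_transitive by blast
  ultimately show False
    using iso by (meson not_ordLess_ordIso ordLeq_ordLess_trans)
qed

lemma ordinal_no_max: "\<exists>b. (a :: ordinal) < b"
proof -
  obtain c where "c \<in> Field aleph2" "Rep_ordinal a \<noteq> c" "(Rep_ordinal a, c) \<in> aleph2"
    using infinite_Card_order_limit[OF Card_order_aleph2 infinite_aleph2 Rep_ordinal[of a]] by blast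
  then have "a < Abs_ordinal c"
    by (auto simp: less_ordinal_def less_eq_ordinal_def Abs_ordinal_inverse)
  then show ?thesis by blast
qed

instantiation ordinal :: conditionally_complete_linorder
begin

definition inf_ordinal :: "ordinal \<Rightarrow> ordinal \<Rightarrow> ordinal" where
  "inf_ordinal = min"

definition sup_ordinal :: "ordinal \<Rightarrow> ordinal \<Rightarrow> ordinal" where
  "sup_ordinal = max"

definition Inf_ordinal :: "ordinal set \<Rightarrow> ordinal" where
  "Inf X = (LEAST a :: ordinal. a \<in> X)"

definition Sup_ordinal :: "ordinal set \<Rightarrow> ordinal" where
  "Sup X = (LEAST a :: ordinal. \<forall>x\<in>X. x \<le> a)"

instance
proof
  fix X :: "ordinal set" and x z :: ordinal
  show "Inf X \<le> x" if "x \<in> X"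
    using that unfolding Inf_ordinal_def by (rule Least_le)
  show "z \<le> Inf X" if "X \<noteq> {}" "\<And>x. x \<in> X \<Longrightarrow> z \<le> x"
    using that unfolding Inf_ordinal_def by (metis LeastI ex_in_conv)
  show "x \<le> Sup X" if "x \<in> X" and bdd: "bdd_above X"
  proof -
    obtain b where "\<forall>x\<in>X. x \<le> b" using bdd by (auto simp: bdd_above_def)
    then have "\<forall>x\<in>X. x \<le> Sup X" unfolding Sup_ordinal_def by (rule LeastI)
    then show ?thesis using that by blast
  qed
  show "Sup X \<le> z" if "\<And>x. x \<in> X \<Longrightarrow> x \<le> z"
    unfolding Sup_ordinal_def by (rule Least_le) (use that in blast)
qed (auto simp: inf_ordinal_def sup_ordinal_def)

end

instantiation ordinal :: zero
begin

definition zero_ordinal :: ordinal where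
  "0 = (LEAST a :: ordinal. True)"

instance ..

end

lemma zero_le_ordinal [simp]: "(0 :: ordinal) \<le> a"
  unfolding zero_ordinal_def by (rule Least_le) simp

lemma Sup_empty_ordinal [simp]: "Sup {} = (0 :: ordinal)"
  by (simp add: Sup_ordinal_def zero_ordinal_def)

definition osuc :: "ordinal \<Rightarrow> ordinal" where
  "osuc a = (LEAST b. a < b)"

lemma osuc_le_iff: "osuc a \<le> b \<longleftrightarrow> a < b"
  unfolding osuc_def by (metis LeastI Least_le leD le_less_linear ordinal_no_max order_less_le_trans)

definition omega1 :: ordinal where
  "omega1 = (LEAST a. uncountable {..<a})"

lemma uncountable_lessThan_omega1:
  includes cardinal_syntax
  shows "uncountable {..<omega1}"
proof -
  have "cardSuc natLeq <o aleph2"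
    by (rule cardSuc_greater[OF Card_order_aleph1])
  moreover have W1: "Well_order (cardSuc natLeq)"
    using Card_order_aleph1 card_order_on_well_order_on by blast
  ultimately obtain c where c: "c \<in> Field aleph2"
    and iso: "cardSuc natLeq =o Restr aleph2 (underS aleph2 c)"
    using ordLess_iff_ordIso_Restr[OF Well_order_aleph2] by blast
  have sub: "underS aleph2 c \<subseteq> Rep_ordinal ` {..<Abs_ordinal c}"
  proof
    fix d assume d: "d \<in> underS aleph2 c"
    then have "d \<in> Field aleph2"
      by (auto simp: underS_def Field_def)
    then have "d = Rep_ordinal (Abs_ordinal d)" "Abs_ordinal d < Abs_ordinal c"
      using c d
      by (auto simp: Abs_ordinal_inverse less_ordinal_def less_eq_ordinal_def underS_def
          Abs_ordinal_inject)
    then show "d \<in> Rep_ordinal ` {..<Abs_ordinal c}" by blast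
  qed
  have "uncountable {..<Abs_ordinal c}"
  proof
    assume "countable {..<Abs_ordinal c}"
    then have "countable (underS aleph2 c)"
      using countable_subset[OF sub] by blast
    then have "countable (Field (Restr aleph2 (underS aleph2 c)))"
      by (rule countable_subset[rotated]) (auto simp: Field_def)
    then have "|Field (Restr aleph2 (underS aleph2 c))| \<le>o natLeq"
      by (meson card_of_nat countable_def card_of_ordLeq ordLeq_ordIso_trans subset_UNIV)
    moreover have "|Field (cardSuc natLeq)| =o |Field (Restr aleph2 (underS aleph2 c))|"
      using iso by (rule card_of_cong)
    moreover have "|Field (cardSuc natLeq)| =o cardSuc natLeq"
      using Card_order_aleph1 card_of_Field_ordIso by blast
    ultimately have "cardSuc natLeq \<le>o natLeq"
      by (meson ordIso_ordLeq_trans ordIso_symmetric)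
    then show False
      using cardSuc_greater[OF natLeq_Card_order] not_ordLess_ordLeq by blast
  qed
  then show ?thesis
    unfolding omega1_def by (rule LeastI)
qed

definition is_tree :: "nat list set \<Rightarrow> bool" where
  "is_tree T \<longleftrightarrow> (\<forall>t\<in>T. \<forall>s. prefix s t \<longrightarrow> s \<in> T)"

definition well_founded_tree :: "nat list set \<Rightarrow> bool" where
  "well_founded_tree T \<longleftrightarrow> \<not> (\<exists>x :: nat \<Rightarrow> nat. \<forall>n. map x [0..<n] \<in> T)"

text \<open>The recursion runs along proper extension of nodes and is meaningful only for nodes of a
  well-founded tree, where it unfolds as stated in \<open>node_rank_eq\<close> below.\<close>

definition node_rank :: "nat list set \<Rightarrow> nat list \<Rightarrow> ordinal" where
  "node_rank T = wfrec {(s, t). s \<in> T \<and> t \<in> T \<and> strict_prefix t s}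
     (\<lambda>\<rho> t. Sup {osuc (\<rho> s) | s. s \<in> T \<and> strict_prefix t s})"

definition tree_rank :: "nat list set \<Rightarrow> ordinal" where
  "tree_rank T =
     (if T = {} then 0
      else if well_founded_tree T then osuc (node_rank T [])
      else omega1)"

lemma is_tree_subgroup_tree: "is_tree (subgroup_tree \<gamma> N)"
proof -
  have "s \<in> gen_tree G g" if "t \<in> gen_tree G g" "prefix s t"
    for s t and G :: "('a, 'b) monoid_scheme" and g
    using that
  proof (induction arbitrary: s)
    case (snoc t i)
    then show ?case by (auto simp: prefix_snoc intro: gen_tree.snoc)
  qed (auto intro: gen_tree.Nil)
  then show ?thesis
    unfolding is_tree_def subgroup_tree_def by blast
qed

lemma wf_extension:
  assumes T: "is_tree T" and wfT: "well_founded_tree T"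
  shows "wf {(s, t). s \<in> T \<and> t \<in> T \<and> strict_prefix t s}"
  unfolding wf_iff_no_infinite_down_chain
proof
  assume "\<exists>f. \<forall>i. (f (Suc i), f i) \<in> {(s, t). s \<in> T \<and> t \<in> T \<and> strict_prefix t s}"
  then obtain f where f: "\<And>i. f i \<in> T" "\<And>i. strict_prefix (f i) (f (Suc i))"
    by auto
  have len: "n \<le> length (f n)" for n
  proof (induction n)
    case (Suc n)
    then show ?case using prefix_length_less[OF f(2)[of n]] by simp
  qed simp
  have mono: "prefix (f i) (f j)" if "i \<le> j" for i j
    using that
  proof (induction rule: dec_induct)
    case (step n)
    then show ?case using f(2)[of n] by (meson prefix_order.less_imp_le prefix_order.trans)
  qed simp
  define x where "x k = f (Suc k) ! k" for k
  have "map x [0..<n] = take n (f n)" for n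
  proof (rule nth_equalityI)
    fix k assume "k < length (map x [0..<n])"
    then have k: "k < n" by simp
    have "f (Suc k) ! k = f n ! k"
      using mono[of "Suc k" n] k len[of "Suc k"] by (auto simp: prefix_def nth_append)
    then show "map x [0..<n] ! k = take n (f n) ! k"
      using k by (simp add: x_def)
  qed (use len[of n] in simp)
  then have "map x [0..<n] \<in> T" for n
    using T f(1)[of n] take_is_prefix unfolding is_tree_def by metis
  then show False
    using wfT unfolding well_founded_tree_def by blast
qed

lemma node_rank_eq:
  assumes "is_tree T" "well_founded_tree T" "t \<in> T"
  shows "node_rank T t = Sup {osuc (node_rank T s) | s. s \<in> T \<and> strict_prefix t s}"
proof -
  have "node_rank T t = Sup {osuc (cut (node_rank T) {(s, t). s \<in> T \<and> t \<in> T \<and> strict_prefix t s} t s)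
      | s. s \<in> T \<and> strict_prefix t s}"
    unfolding node_rank_def by (subst wfrec[OF wf_extension[OF assms(1,2)]]) (rule refl)
  also have "{osuc (cut (node_rank T) {(s, t). s \<in> T \<and> t \<in> T \<and> strict_prefix t s} t s)
      | s. s \<in> T \<and> strict_prefix t s} = {osuc (node_rank T s) | s. s \<in> T \<and> strict_prefix t s}"
    using assms(3) by (force simp: cut_def)
  finally show ?thesis .
qed

end

theory Submission
  imports Defs
begin

text \<open>An isomorphism of groups turns each enumerated element of the first group into some enumerated
  element of the second, though possibly with a different index. Choosing such an index \<open>f i\<close> for
  every \<open>i\<close> and relabelling sequences term by term gives a map from the first subgroup tree to the
  second (\<open>map_in_gen_tree\<close>): isomorphisms carry generated subgroups to generated subgroups
  injectively, so a strict growth of the subgroup stays strict. The relabelling may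
  identify nodes and may miss some, but it preserves strict extension of sequences, and that is enough for
  ranks not to decrease and for infinite branches to be carried to infinite branches
  (\<open>node_rank_le_map\<close>, \<open>well_founded_tree_map\<close>). The inverse isomorphism gives a relabelling in the
  other direction, whence equality of the ranks. Two relabellings are also what settles the
  ill-founded case: either both trees have an infinite branch or neither does.\<close>

lemma strict_prefix_map: "strict_prefix s t \<Longrightarrow> strict_prefix (map f s) (map f t)"
  by (auto simp: strict_prefix_def prefix_def)

lemma well_founded_tree_map:
  assumes f: "\<And>s. s \<in> T \<Longrightarrow> map f s \<in> T'" and wf: "well_founded_tree T'"
  shows "well_founded_tree T"
  unfolding well_founded_tree_def
proof
  assume "\<exists>x. \<forall>n. map x [0..<n] \<in> T"
  then obtain x where "\<And>n. map x [0..<n] \<in> T" by blast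
  then have "map (f \<circ> x) [0..<n] \<in> T'" for n
    using f by fastforce
  then show False
    using wf unfolding well_founded_tree_def by blast
qed

text \<open>A supremum in \<^typ>\<open>ordinal\<close> is an upper bound only of a bounded set; countably many nodes
  give a countable, hence bounded, set of ranks.\<close>

lemma node_rank_less:
  assumes "is_tree T" "well_founded_tree T" "t \<in> T" "s \<in> T" "strict_prefix t s"
  shows "node_rank T s < node_rank T t"
proof -
  let ?X = "{osuc (node_rank T s) | s. s \<in> T \<and> strict_prefix t s}"
  have "countable ?X"
    by (rule countable_subset[of _ "range (\<lambda>s. osuc (node_rank T s))"]) auto
  then have "osuc (node_rank T s) \<le> Sup ?X"
    by (intro cSup_upper countable_bdd_above_ordinal) (use assms in auto)
  then show ?thesis
    using assms by (simp add: node_rank_eq osuc_le_iff)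
qed

text \<open>By induction from the longer nodes of \<open>T\<close> to the shorter: every proper extension \<open>s\<close> of \<open>t\<close>
  yields a proper extension \<open>map f s\<close> of \<open>map f t\<close>, whose rank is at least that of \<open>s\<close>.\<close>

lemma node_rank_le_map:
  assumes T: "is_tree T" and T': "is_tree T'" "well_founded_tree T'"
    and f: "\<And>s. s \<in> T \<Longrightarrow> map f s \<in> T'" and "t \<in> T"
  shows "node_rank T t \<le> node_rank T' (map f t)"
proof -
  have wfT: "well_founded_tree T"
    using f T'(2) by (rule well_founded_tree_map)
  show ?thesis
    using \<open>t \<in> T\<close>
  proof (induction t rule: wf_induct_rule[OF wf_extension[OF T wfT]])
    case (1 t)
    have "osuc (node_rank T s) \<le> node_rank T' (map f t)" if "s \<in> T" "strict_prefix t s" for s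
    proof -
      have "node_rank T s \<le> node_rank T' (map f s)"
        using 1 that by blast
      also have "\<dots> < node_rank T' (map f t)"
        using T' f 1 that by (intro node_rank_less strict_prefix_map) auto
      finally show ?thesis by (simp add: osuc_le_iff)
    qed
    \<comment> \<open>The set of ranks is empty when \<open>t\<close> has no proper extension in \<open>T\<close>, so the bound comes
      from the definition of \<open>Sup\<close> as a least upper bound and not from \<open>cSup_least\<close>.\<close>
    then show ?case
      unfolding node_rank_eq[OF T wfT \<open>t \<in> T\<close>] Sup_ordinal_def by (intro Least_le) auto
  qed
qed

lemma tree_rank_eq_if_maps:
  assumes "is_tree T" "is_tree T'"
    and "\<And>s. s \<in> T \<Longrightarrow> map f s \<in> T'" "\<And>s. s \<in> T' \<Longrightarrow> map f' s \<in> T"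
  shows "tree_rank T = tree_rank T'"
proof (cases "T = {} \<or> \<not> well_founded_tree T")
  case True
  then show ?thesis
    using assms(3,4) well_founded_tree_map[of T f T'] well_founded_tree_map[of T' f' T]
    by (auto simp: tree_rank_def)
next
  case False
  then have wf: "well_founded_tree T" "well_founded_tree T'"
    using well_founded_tree_map[OF assms(4)] by auto
  have ne: "T' \<noteq> {}" using False assms(3) by blast
  have root: "[] \<in> T" "[] \<in> T'"
    using False ne assms(1,2) by (auto simp: is_tree_def)
  have "node_rank T [] = node_rank T' []"
    using node_rank_le_map[OF assms(1,2) wf(2) assms(3) root(1)]
      node_rank_le_map[OF assms(2,1) wf(1) assms(4) root(2)] by simp
  then show ?thesis
    using False wf ne by (simp add: tree_rank_def)
qed

lemma is_tree_gen_tree: "is_tree (gen_tree G g)"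
proof -
  have "s \<in> gen_tree G g" if "t \<in> gen_tree G g" "prefix s t" for s t
    using that
    by (induction arbitrary: s) (auto simp: prefix_snoc intro: gen_tree.intros)
  then show ?thesis
    unfolding is_tree_def by blast
qed

text \<open>The sequence \<open>map f s\<close> enumerates the \<open>h\<close>-image of what \<open>s\<close> enumerates, and \<open>h\<close> commutes with
  generating subgroups. Injectivity keeps two distinct subgroups distinct after applying \<open>h\<close>.\<close>

lemma (in group_hom) map_in_gen_tree:
  assumes inj: "inj_on h (carrier G)" and g: "range g \<subseteq> carrier G"
    and f: "\<And>i. g' (f i) = h (g i)" and "s \<in> gen_tree G g"
  shows "map f s \<in> gen_tree H g'"
  using \<open>s \<in> gen_tree G g\<close>
proof induction
  case Nil
  show ?case by (simp add: gen_tree.Nil)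
next
  case (snoc s i)
  let ?A = "g ` set s" and ?B = "g ` set s \<union> {g i}"
  have sub: "?A \<subseteq> carrier G" "?B \<subseteq> carrier G" using g by auto
  have "h ` generate G ?B \<noteq> h ` generate G ?A"
    using snoc.hyps(2) inj_on_image_eq_iff[OF inj G.generate_incl[OF sub(2)] G.generate_incl[OF sub(1)]]
    by simp
  then have "generate H (h ` ?B) \<noteq> generate H (h ` ?A)"
    using generate_img[OF sub(1)] generate_img[OF sub(2)] by simp
  moreover have "g' ` set (map f s) = h ` ?A" "g' ` set (map f s) \<union> {g' (f i)} = h ` ?B"
    by (auto simp: f image_image)
  ultimately show ?case
    using snoc.IH by (simp add: gen_tree_snoc_iff)
qed

lemma iso_relabels_gen_tree:
  assumes "group G" "group G'" "G \<cong> G'" "range g = carrier G" "range g' = carrier G'"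
  shows "\<exists>f. \<forall>s \<in> gen_tree G g. map f s \<in> gen_tree G' g'"
proof -
  obtain h where h: "h \<in> hom G G'" "bij_betw h (carrier G) (carrier G')"
    using assms(3) by (auto simp: is_iso_def iso_def)
  interpret group_hom G G' h
    using assms(1,2) h(1) by (simp add: group_hom_def group_hom_axioms_def)
  have "\<exists>j. g' j = h (g i)" for i
    using assms(4,5) by (metis hom_closed rangeI imageE)
  then obtain f where "\<And>i. g' (f i) = h (g i)" by metis
  then show ?thesis
    using map_in_gen_tree[of g g' f] h(2) assms(4) by (auto simp: bij_betw_def)
qed

lemma tree_rank_gen_tree_cong:
  assumes "group G" "group G'" "G \<cong> G'" "range g = carrier G" "range g' = carrier G'"
  shows "tree_rank (gen_tree G g) = tree_rank (gen_tree G' g')"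
proof -
  have "G' \<cong> G" using assms(1,3) by (rule group.iso_sym)
  then show ?thesis
    using iso_relabels_gen_tree[OF assms] iso_relabels_gen_tree[OF assms(2,1) _ assms(5,4)]
      tree_rank_eq_if_maps[OF is_tree_gen_tree is_tree_gen_tree] by metis
qed

text \<open>The marking uses left cosets and the quotient group right cosets; they agree by normality.\<close>

lemma range_marking:
  assumes "range \<gamma> = carrier free_group" "N \<lhd> free_group"
  shows "range (marking \<gamma> N) = carrier (marked_group N)"
proof -
  have "range (marking \<gamma> N) = (\<lambda>x. x <#\<^bsub>free_group\<^esub> N) ` carrier free_group"
    by (simp add: marking_def image_image flip: assms(1))
  also have "\<dots> = (\<lambda>x. N #>\<^bsub>free_group\<^esub> x) ` carrier free_group"
    using normal.coset_eq[OF assms(2)] by auto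
  finally show ?thesis
    by (auto simp: marked_group_def FactGroup_def RCOSETS_def)
qed

theorem corollary4p5:
  fixes \<gamma> :: "nat \<Rightarrow> letter list" and N N' :: "letter list set"
  assumes "range \<gamma> = carrier free_group"
    and "N \<lhd> free_group" and "N' \<lhd> free_group"
    and "marked_group N \<cong> marked_group N'"
  shows "tree_rank (subgroup_tree \<gamma> N) = tree_rank (subgroup_tree \<gamma> N')"
  unfolding subgroup_tree_def
proof (rule tree_rank_gen_tree_cong)
  show "group (marked_group N)" "group (marked_group N')"
    using assms(2,3) by (simp_all add: marked_group_def normal.factorgroup_is_group)
qed (use assms range_marking in auto)

end
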